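(* Let $(\mathfrak g,[\cdot,\cdot]_{\mathfrak g},\omega,N)$ be a para-Kähler Lie algebra and let $(\mathfrak g,\cdot_{\mathfrak g},\omega)$ be the associated quadratic pre-Lie algebra, whose product is determined by $\omega(x\cdot_{\mathfrak g}y,z)=-\omega(y,[x,z]_{\mathfrak g})$ for all $x,y,z\in\mathfrak g$. Then: (i) $(\mathfrak g,\cdot_{\mathfrak g},\omega,N)$ is a para-complex quadratic pre-Lie algebra; (ii) $(\mathfrak g,[\cdot,\cdot]_N,\omega)$ is a symplectic Lie algebra and $(\mathfrak g,[\cdot,\cdot]_N,\omega,N)$ is also a para-Kähler Lie algebra, where $[x,y]_N=[N(x),y]_{\mathfrak g}+[x,N(y)]_{\mathfrak g}-N([x,y]_{\mathfrak g})$; (iii) $(\mathfrak g,\cdot_N)$, where $x\cdot_Ny=N(x)\cdot_{\mathfrak g}y+x\cdot_{\mathfrak g}N(y)-N(x\cdot_{\mathfrak g}y)$, is the pre-Lie algebra associated to the symplectic Lie algebra $(\mathfrak g,[\cdot,\cdot]_N,\omega)$, i.e. $\omega(x\cdot_Ny,z)=-\omega(y,[x,z]_N)$ for all $x,y,z\in\mathfrak g$.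
   Context: $\mathbb K$ is an algebraically closed field of characteristic $0$; vector spaces are finite dimensional over $\mathbb K$. A pre-Lie algebra is a vector space $\mathfrak g$ with a bilinear product $\cdot_{\mathfrak g}$ such that $(x\cdot_{\mathfrak g} y)\cdot_{\mathfrak g} z-x\cdot_{\mathfrak g}(y\cdot_{\mathfrak g} z)$ is symmetric in $x,y$; $[x,y]^c=x\cdot_{\mathfrak g}y-y\cdot_{\mathfrak g}x$ is its commutator Lie bracket. A symplectic Lie algebra $(\mathfrak g,[\cdot,\cdot]_{\mathfrak g},\omega)$ is a Lie algebra with a nondegenerate skew-symmetric bilinear form $\omega$ satisfying $\omega([x,y]_{\mathfrak g},z)+\omega([z,x]_{\mathfrak g},y)+\omega([y,z]_{\mathfrak g},x)=0$. A quadratic pre-Lie algebra $(\mathfrak g,\cdot_{\mathfrak g},\omega)$ is a pre-Lie algebra with a nondegenerate skew-symmetric bilinear form satisfying $\omega(x\cdot_{\mathfrak g}y,z)+\omega(y,[x,z]^c)=0$. It is known (Chu) that for a symplectic Lie algebra, the formula $\omega(x\cdot_{\mathfrak g}y,z)=-\omega(y,[x,z]_{\mathfrak g})$ defines a pre-Lie product whose commutator is $[\cdot,\cdot]_{\mathfrak g}$, and $(\mathfrak g,\cdot_{\mathfrak g},\omega)$ is then a quadratic pre-Lie algebra (the associated one). A Nijenhuis operator on an algebra with bilinear product $\ast$ (either a Lie bracket or a pre-Lie product) is a linear map $N$ with $N(x)\ast N(y)=N\big(N(x)\ast y+x\ast N(y)-N(x\ast y)\big)$ for all $x,y$. A para-complex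 structure on a Lie algebra (resp. pre-Lie algebra) is a Nijenhuis operator $N$ on it with $N^2=\mathrm{Id}$ and $\dim\ker(N+\mathrm{Id})=\dim\ker(N-\mathrm{Id})$. A para-Kähler Lie algebra $(\mathfrak g,[\cdot,\cdot]_{\mathfrak g},\omega,N)$ is a symplectic Lie algebra with a para-complex structure $N$ on the Lie algebra such that $\omega(N(x),y)=-\omega(x,N(y))$ for all $x,y$. A para-complex quadratic pre-Lie algebra $(\mathfrak g,\cdot_{\mathfrak g},\omega,N)$ is a quadratic pre-Lie algebra with a para-complex structure $N$ on the pre-Lie algebra such that $\omega(N(x),y)=-\omega(x,N(y))$ for all $x,y$. *)

theory Defs
  imports "HOL-Computational_Algebra.Polynomial"
begin

section \<open>Bilinear maps and algebras\<close>

text \<open>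
  The underlying vector space is the whole type \<open>'v\<close>, with scalar multiplication \<open>scale\<close>
  over the field type \<open>'k\<close>.
\<close>

definition bilinear_map ::
    "('k::field \<Rightarrow> 'a::ab_group_add \<Rightarrow> 'a) \<Rightarrow> ('k \<Rightarrow> 'b::ab_group_add \<Rightarrow> 'b) \<Rightarrow>
     ('k \<Rightarrow> 'c::ab_group_add \<Rightarrow> 'c) \<Rightarrow> ('a \<Rightarrow> 'b \<Rightarrow> 'c) \<Rightarrow> bool" where
  "bilinear_map s1 s2 s3 f \<longleftrightarrow>
     (\<forall>x. Vector_Spaces.linear s2 s3 (f x)) \<and> (\<forall>y. Vector_Spaces.linear s1 s3 (\<lambda>x. f x y))"

definition commutator :: "('v::ab_group_add \<Rightarrow> 'v \<Rightarrow> 'v) \<Rightarrow> 'v \<Rightarrow> 'v \<Rightarrow> 'v" where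
  "commutator pr x y = pr x y - pr y x"

definition deformed_product ::
    "('v::ab_group_add \<Rightarrow> 'v \<Rightarrow> 'v) \<Rightarrow> ('v \<Rightarrow> 'v) \<Rightarrow> 'v \<Rightarrow> 'v \<Rightarrow> 'v" where
  "deformed_product pr N x y = pr (N x) y + pr x (N y) - N (pr x y)"

locale bilinear_algebra = vector_space scale
  for scale :: "'k::field \<Rightarrow> 'v::ab_group_add \<Rightarrow> 'v" +
  fixes pr :: "'v \<Rightarrow> 'v \<Rightarrow> 'v"
  assumes bilinear_product: "bilinear_map scale scale scale pr"

locale lie_algebra = bilinear_algebra scale br
  for scale :: "'k::field \<Rightarrow> 'v::ab_group_add \<Rightarrow> 'v" and br :: "'v \<Rightarrow> 'v \<Rightarrow> 'v" +
  assumes bracket_self: "br x x = 0"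
    and jacobi: "br x (br y z) + br y (br z x) + br z (br x y) = 0"

locale pre_lie_algebra = bilinear_algebra scale pl
  for scale :: "'k::field \<Rightarrow> 'v::ab_group_add \<Rightarrow> 'v" and pl :: "'v \<Rightarrow> 'v \<Rightarrow> 'v" +
  assumes associator_symmetric:
    "pl (pl x y) z - pl x (pl y z) = pl (pl y x) z - pl y (pl x z)"

section \<open>Symplectic Lie algebras and quadratic pre-Lie algebras\<close>

locale symplectic_form = vector_space scale
  for scale :: "'k::field \<Rightarrow> 'v::ab_group_add \<Rightarrow> 'v" +
  fixes \<omega> :: "'v \<Rightarrow> 'v \<Rightarrow> 'k"
  assumes bilinear_form: "bilinear_map scale scale (*) \<omega>"
    and skew: "\<omega> x y = - \<omega> y x"
    and nondegenerate: "(\<And>y. \<omega> x y = 0) \<Longrightarrow> x = 0"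

locale symplectic_lie_algebra = lie_algebra scale br + symplectic_form scale \<omega>
  for scale :: "'k::field \<Rightarrow> 'v::ab_group_add \<Rightarrow> 'v" and br :: "'v \<Rightarrow> 'v \<Rightarrow> 'v"
    and \<omega> :: "'v \<Rightarrow> 'v \<Rightarrow> 'k" +
  assumes closed_form: "\<omega> (br x y) z + \<omega> (br z x) y + \<omega> (br y z) x = 0"

locale quadratic_pre_lie_algebra = pre_lie_algebra scale pl + symplectic_form scale \<omega>
  for scale :: "'k::field \<Rightarrow> 'v::ab_group_add \<Rightarrow> 'v" and pl :: "'v \<Rightarrow> 'v \<Rightarrow> 'v"
    and \<omega> :: "'v \<Rightarrow> 'v \<Rightarrow> 'k" +
  assumes invariant_form: "\<omega> (pl x y) z + \<omega> y (commutator pl x z) = 0"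

text \<open>
  The product \<open>x \<cdot> y\<close> determined by \<open>\<omega> (x \<cdot> y) z = - \<omega> y [x, z]\<close> for all \<open>z\<close>. The lemmas
  \<open>associated_product_form\<close> and \<open>associated_product_unique\<close> below show that, in finite
  dimension, the description is well defined.
\<close>

definition associated_product ::
    "('v \<Rightarrow> 'v \<Rightarrow> 'k::field) \<Rightarrow> ('v \<Rightarrow> 'v \<Rightarrow> 'v) \<Rightarrow> 'v \<Rightarrow> 'v \<Rightarrow> 'v" where
  "associated_product \<omega> br x y = (THE u. \<forall>z. \<omega> u z = - \<omega> y (br x z))"

section \<open>Nijenhuis operators and para-complex structures\<close>

locale nijenhuis_operator = bilinear_algebra scale pr
  for scale :: "'k::field \<Rightarrow> 'v::ab_group_add \<Rightarrow> 'v" and pr :: "'v \<Rightarrow> 'v \<Rightarrow> 'v" +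
  fixes N :: "'v \<Rightarrow> 'v"
  assumes linear_N: "Vector_Spaces.linear scale scale N"
    and nijenhuis: "pr (N x) (N y) = N (pr (N x) y + pr x (N y) - N (pr x y))"

text \<open>The two sets below are the kernels of \<open>N + Id\<close> and \<open>N - Id\<close>.\<close>

locale para_complex_structure = nijenhuis_operator scale pr N
  for scale :: "'k::field \<Rightarrow> 'v::ab_group_add \<Rightarrow> 'v" and pr :: "'v \<Rightarrow> 'v \<Rightarrow> 'v"
    and N :: "'v \<Rightarrow> 'v" +
  assumes involution: "N (N x) = x"
    and dim_kernels_eq: "dim {x. N x + x = 0} = dim {x. N x - x = 0}"

locale para_kaehler_lie_algebra =
    symplectic_lie_algebra scale br \<omega> + para_complex_structure scale br N
  for scale :: "'k::field \<Rightarrow> 'v::ab_group_add \<Rightarrow> 'v" and br :: "'v \<Rightarrow> 'v \<Rightarrow> 'v"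
    and \<omega> :: "'v \<Rightarrow> 'v \<Rightarrow> 'k" and N :: "'v \<Rightarrow> 'v" +
  assumes form_N_skew: "\<omega> (N x) y = - \<omega> x (N y)"

locale para_complex_quadratic_pre_lie_algebra =
    quadratic_pre_lie_algebra scale pl \<omega> + para_complex_structure scale pl N
  for scale :: "'k::field \<Rightarrow> 'v::ab_group_add \<Rightarrow> 'v" and pl :: "'v \<Rightarrow> 'v \<Rightarrow> 'v"
    and \<omega> :: "'v \<Rightarrow> 'v \<Rightarrow> 'k" and N :: "'v \<Rightarrow> 'v" +
  assumes form_N_skew: "\<omega> (N x) y = - \<omega> x (N y)"

section \<open>Well-definedness of the associated product\<close>

context symplectic_form
begin

lemma form_linear:
  "Vector_Spaces.linear scale (*) (\<omega> x)" "Vector_Spaces.linear scale (*) (\<lambda>x. \<omega> x y)"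
  using bilinear_form unfolding bilinear_map_def by auto

lemma form_diff_left: "\<omega> (x - y) z = \<omega> x z - \<omega> y z"
  using module_hom.diff[OF Vector_Spaces.linear.axioms(3)[OF form_linear(2)]] .

lemma form_eqI: "(\<And>z. \<omega> u z = \<omega> v z) \<Longrightarrow> u = v"
  using nondegenerate[of "u - v"] by (simp add: form_diff_left)

lemma form_represents:
  assumes fin: "finite_dimensional_vector_space scale B"
    and g: "Vector_Spaces.linear scale (*) g"
  shows "\<exists>u. \<forall>z. \<omega> u z = g z"
proof -
  interpret fd: finite_dimensional_vector_space scale B by (rule fin)
  interpret fp: finite_dimensional_vector_space_pair scale B scale B ..
  interpret vp: vector_space_pair scale "(*) :: 'k \<Rightarrow> 'k \<Rightarrow> 'k"
    using g by (simp add: Vector_Spaces.linear_def vector_space_pair_def)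
  define T where "T u = (\<Sum>b\<in>B. scale (\<omega> u b) b)" for u
  have lT: "Vector_Spaces.linear scale scale T"
  proof (unfold Vector_Spaces.linear_iff, intro conjI allI vector_space_axioms)
    fix x y :: "'v" and c :: "'k"
    show "T (x + y) = T x + T y"
      unfolding T_def
      using module_hom.add[OF Vector_Spaces.linear.axioms(3)[OF form_linear(2)]]
      by (simp add: scale_left_distrib sum.distrib)
    show "T (scale c x) = scale c (T x)"
      unfolding T_def
      using module_hom.scale[OF Vector_Spaces.linear.axioms(3)[OF form_linear(2)]]
      by (simp add: scale_sum_right)
  qed
  have T_eq: "\<omega> u z = g z" if T: "T u = (\<Sum>b\<in>B. scale (g b) b)" for u z
  proof -
    have "(\<Sum>b\<in>B. scale (\<omega> u b - g b) b) = 0"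
      using T by (simp add: T_def scale_left_diff_distrib sum_subtractf)
    then have eq: "\<omega> u b = g b" if "b \<in> B" for b
      using independentD[OF fd.independent_Basis fd.finite_Basis subset_refl _ that,
          of "\<lambda>b. \<omega> u b - g b"] by simp
    show ?thesis
      by (rule vp.linear_eq_on[OF form_linear(1) g _ eq, of z B])
        (auto simp: fd.span_Basis)
  qed
  have "inj T"
  proof (rule injI)
    fix u v assume uv: "T u = T v"
    have "(\<Sum>b\<in>B. scale (\<omega> u b - \<omega> v b) b) = 0"
      using uv by (simp add: T_def scale_left_diff_distrib sum_subtractf)
    then have eq: "\<omega> u b = \<omega> v b" if "b \<in> B" for b
      using independentD[OF fd.independent_Basis fd.finite_Basis subset_refl _ that,
          of "\<lambda>b. \<omega> u b - \<omega> v b"] by simp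
    show "u = v"
      by (rule form_eqI, rule vp.linear_eq_on[OF form_linear(1) form_linear(1) _ eq])
        (auto simp: fd.span_Basis)
  qed
  then have "surj T"
    by (rule fp.linear_injective_imp_surjective[OF lT]) simp
  then show ?thesis
    using T_eq by (metis surjD)
qed

end

context symplectic_lie_algebra
begin

lemma associated_product_ex1:
  assumes "finite_dimensional_vector_space scale B"
  shows "\<exists>!u. \<forall>z. \<omega> u z = - \<omega> y (br x z)"
proof -
  have "Vector_Spaces.linear scale scale (br x)"
    using bilinear_product unfolding bilinear_map_def by blast
  then have "Vector_Spaces.linear scale (*) (\<omega> y \<circ> br x)"
    using form_linear(1) by (rule Vector_Spaces.linear_compose)
  then have "Vector_Spaces.linear scale (*) (\<lambda>z. - \<omega> y (br x z))"
    using vector_space_pair.linear_compose_neg[of scale "(*)" "\<omega> y \<circ> br x"]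
    by (simp add: Vector_Spaces.linear_def vector_space_pair_def)
  from form_represents[OF assms this] show ?thesis
    using form_eqI by metis
qed

lemma associated_product_form:
  assumes "finite_dimensional_vector_space scale B"
  shows "\<omega> (associated_product \<omega> br x y) z = - \<omega> y (br x z)"
  unfolding associated_product_def using theI'[OF associated_product_ex1[OF assms]] by blast

lemma associated_product_unique:
  assumes "\<And>x y z. \<omega> (pl x y) z = - \<omega> y (br x z)"
  shows "pl = associated_product \<omega> br"
proof (intro ext)
  fix x y
  show "pl x y = associated_product \<omega> br x y"
    unfolding associated_product_def
    by (rule the_equality[symmetric]) (auto simp: assms intro: form_eqI)
qed

end

end

theory Submission
  imports Defs
begin

text \<open>
  Two ideas carry the proof.

  The form turns identities for the product into identities for the bracket. The relation
  \<open>\<omega> (x \<cdot> y) z = - \<omega> y [x, z]\<close> says that left multiplication by \<open>x\<close> is minus the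
  \<open>\<omega>\<close>-adjoint of the adjoint action of \<open>x\<close>, and \<open>\<omega> (N x) y = - \<omega> x (N y)\<close> says that \<open>N\<close> is
  minus its own adjoint. Since \<open>\<omega>\<close> is nondegenerate, an identity for \<open>\<cdot>\<close> may be tested by pairing
  with a vector \<open>z\<close> and moving every operation to the other side. In this way the pre-Lie identity
  becomes the Jacobi identity (\<open>compatible_product_pre_lie\<close>), and the Nijenhuis identity for \<open>\<cdot>\<close>
  becomes the one for the bracket (\<open>compatible_product_nijenhuis\<close>). The latter is the only
  computation that uses \<open>N\<^sup>2 = Id\<close>: taking adjoints moves the outer \<open>N\<close> of the Nijenhuis
  identity onto one of the arguments, and \<open>N\<^sup>2 = Id\<close> moves it back.

  Deforming by \<open>N\<close> preserves every structure in sight. For the Lie bracket this is the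
  classical fact that \<open>N\<close> maps the deformed bracket to the original one. With it the Jacobi
  identity of \<open>[x, y]\<^sub>N\<close> reduces to seven instances of the original identity, and \<open>N\<close> remains a
  Nijenhuis operator. Closedness of \<open>\<omega>\<close> for \<open>[x, y]\<^sub>N\<close> is the sum of the three closedness
  identities in which \<open>N\<close> is applied to one of the arguments. Finally, the relation between \<open>\<cdot>\<close> and
  the bracket is itself inherited by the deformations (\<open>deformed_product_compatible\<close>), which
  identifies \<open>\<cdot>\<^sub>N\<close> as the product associated to \<open>[x, y]\<^sub>N\<close>; its pre-Lie identity then needs no
  computation of its own.
\<close>

section \<open>Bilinearity\<close>

lemma bilinear_map_iff:
  assumes "vector_space s1" "vector_space s2" "vector_space s3"
  shows "bilinear_map s1 s2 s3 f \<longleftrightarrow>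
    (\<forall>x y z. f (x + y) z = f x z + f y z) \<and> (\<forall>x y z. f x (y + z) = f x y + f x z) \<and>
    (\<forall>c x y. f (s1 c x) y = s3 c (f x y)) \<and> (\<forall>c x y. f x (s2 c y) = s3 c (f x y))"
  using assms unfolding bilinear_map_def Vector_Spaces.linear_iff by blast

lemma vector_space_mult: "vector_space ((*) :: 'k::field \<Rightarrow> 'k \<Rightarrow> 'k)"
  by unfold_locales (simp_all add: algebra_simps)

context bilinear_algebra
begin

lemma product_add: "pr (x + y) z = pr x z + pr y z" "pr x (y + z) = pr x y + pr x z"
  and product_scale: "pr (scale c x) y = scale c (pr x y)" "pr x (scale c y) = scale c (pr x y)"
  using bilinear_product
  unfolding bilinear_map_iff[OF vector_space_axioms vector_space_axioms vector_space_axioms]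
  by blast+

lemma product_zero: "pr 0 x = 0" "pr x 0 = 0"
  using product_add(1)[of 0 0 x] product_add(2)[of x 0 0] by simp_all

lemma product_minus: "pr (- x) y = - pr x y" "pr x (- y) = - pr x y"
  using product_add(1)[of x "- x" y] product_add(2)[of x y "- y"]
  by (simp_all add: product_zero eq_neg_iff_add_eq_0 add.commute)

lemma product_diff: "pr (x - y) z = pr x z - pr y z" "pr x (y - z) = pr x y - pr x z"
  using product_add(1)[of x "- y" z] product_add(2)[of x y "- z"] by (simp_all add: product_minus)

end

context symplectic_form
begin

lemma form_add: "\<omega> (x + y) z = \<omega> x z + \<omega> y z" "\<omega> x (y + z) = \<omega> x y + \<omega> x z"
  and form_scale: "\<omega> (scale c x) y = c * \<omega> x y" "\<omega> x (scale c y) = c * \<omega> x y"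
  using bilinear_form
  unfolding bilinear_map_iff[OF vector_space_axioms vector_space_axioms vector_space_mult]
  by blast+

lemma form_zero_right: "\<omega> x 0 = 0"
  using form_scale(2)[of x 0 0] by simp

lemma form_minus_right: "\<omega> x (- y) = - \<omega> x y"
  using form_add(2)[of x y "- y"] by (simp add: form_zero_right eq_neg_iff_add_eq_0 add.commute)

lemma form_diff_right: "\<omega> x (y - z) = \<omega> x y - \<omega> x z"
  using form_add(2)[of x y "- z"] by (simp add: form_minus_right)

end

lemma (in lie_algebra) bracket_skew: "br x y = - br y x"
proof -
  have "br x x + br x y + (br y x + br y y) = 0"
    using bracket_self[of "x + y"] by (simp only: product_add ac_simps)
  then show ?thesis
    by (simp add: bracket_self eq_neg_iff_add_eq_0)
qed


section \<open>Deformation of an algebra by a Nijenhuis operator\<close>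

context nijenhuis_operator
begin

lemma N_add: "N (x + y) = N x + N y"
  and N_scale: "N (scale c x) = scale c (N x)"
  using linear_N unfolding Vector_Spaces.linear_iff by blast+

lemma N_diff: "N (x - y) = N x - N y"
  using N_add[of "x - y" y] by (simp add: algebra_simps)

lemma N_deformed_product: "N (deformed_product pr N x y) = pr (N x) (N y)"
  by (simp add: deformed_product_def nijenhuis)

lemma bilinear_algebra_deformed: "bilinear_algebra scale (deformed_product pr N)"
proof unfold_locales
  show "bilinear_map scale scale scale (deformed_product pr N)"
    unfolding bilinear_map_iff[OF vector_space_axioms vector_space_axioms vector_space_axioms]
    by (simp add: deformed_product_def product_add product_scale N_add N_scale
        scale_right_distrib scale_right_diff_distrib)
qed

text \<open>
  Each side of the identity expands, through \<open>N_deformed_product\<close>, into products of vectors of the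
  form \<open>N x\<close> and \<open>N (N x)\<close> and into \<open>N\<close> of such a product, and these agree term by term.
\<close>

lemma nijenhuis_deformed: "nijenhuis_operator scale (deformed_product pr N) N"
proof -
  interpret deformed: bilinear_algebra scale "deformed_product pr N"
    by (rule bilinear_algebra_deformed)
  show ?thesis
  proof unfold_locales
    fix x y
    have "deformed_product pr N (N x) (N y)
        = pr (N (N x)) (N y) + pr (N x) (N (N y)) - N (pr (N x) (N y))"
      by (simp add: deformed_product_def)
    then show "deformed_product pr N (N x) (N y)
        = N (deformed_product pr N (N x) y + deformed_product pr N x (N y)
            - N (deformed_product pr N x y))"
      by (simp add: N_add N_diff N_deformed_product)
  qed (simp_all add: N_add N_scale)
qed

end

text \<open>
  Expanding \<open>[x, [y, z]\<^sub>N]\<^sub>N\<close> and using the Nijenhuis identity for \<open>[N x, N [y, z]]\<close>, the terms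
  \<open>N [x, N [y, z]]\<close> cancel. What is left is an expression in nested brackets with two, one or no
  arguments replaced by their images under \<open>N\<close>, and its cyclic sum consists of \<open>3 + 3 + 1\<close> Jacobi
  identities.
\<close>

lemma lie_algebra_deformed:
  assumes "lie_algebra scale br" and "nijenhuis_operator scale br N"
  shows "lie_algebra scale (deformed_product br N)"
proof -
  interpret lie_algebra scale br by (rule assms)
  interpret nijenhuis_operator scale br N by (rule assms)
  interpret deformed: bilinear_algebra scale "deformed_product br N"
    by (rule bilinear_algebra_deformed)
  have expand: "deformed_product br N x (deformed_product br N y z)
      = (br (N x) (br (N y) z) + br (N x) (br y (N z)) + br x (br (N y) (N z)))
        - N (br (N x) (br y z) + br x (br (N y) z) + br x (br y (N z)))
        + N (N (br x (br y z)))" for x y z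
  proof -
    have "deformed_product br N x (deformed_product br N y z)
        = br (N x) (deformed_product br N y z) + br x (br (N y) (N z))
          - N (br x (deformed_product br N y z))"
      by (simp only: deformed_product_def[of br N x] N_deformed_product)
    then show ?thesis
      by (simp add: deformed_product_def product_add product_diff N_add N_diff
          nijenhuis[of x "br y z"])
  qed
  have N_jacobi: "N (br x (br y z)) + N (br y (br z x)) + N (br z (br x y)) = 0" for x y z
    using jacobi[of x y z] N_diff[of 0 0] by (simp flip: N_add)
  have NN_jacobi: "N (N (br x (br y z))) + N (N (br y (br z x))) + N (N (br z (br x y))) = 0"
    for x y z
    using N_jacobi[of x y z] N_diff[of 0 0] by (simp flip: N_add)
  show ?thesis
  proof unfold_locales
    fix x
    show "deformed_product br N x x = 0"
      using bracket_skew[of "N x" x] N_diff[of 0 0] by (simp add: deformed_product_def bracket_self)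
  next
    fix x y z
    have "deformed_product br N x (deformed_product br N y z)
        + deformed_product br N y (deformed_product br N z x)
        + deformed_product br N z (deformed_product br N x y)
      = (br (N x) (br (N y) z) + br (N y) (br z (N x)) + br z (br (N x) (N y)))
        + (br (N x) (br y (N z)) + br y (br (N z) (N x)) + br (N z) (br (N x) y))
        + (br x (br (N y) (N z)) + br (N y) (br (N z) x) + br (N z) (br x (N y)))
        - (N (br (N x) (br y z)) + N (br y (br z (N x))) + N (br z (br (N x) y)))
        - (N (br x (br (N y) z)) + N (br (N y) (br z x)) + N (br z (br x (N y))))
        - (N (br x (br y (N z))) + N (br y (br (N z) x)) + N (br (N z) (br x y)))
        + (N (N (br x (br y z))) + N (N (br y (br z x))) + N (N (br z (br x y))))"
      unfolding expand N_add by (simp add: algebra_simps)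
    also have "\<dots> = 0"
      unfolding jacobi N_jacobi NN_jacobi by simp
    finally show "deformed_product br N x (deformed_product br N y z)
        + deformed_product br N y (deformed_product br N z x)
        + deformed_product br N z (deformed_product br N x y) = 0" .
  qed
qed


section \<open>Products compatible with a symplectic Lie algebra\<close>

context symplectic_lie_algebra
begin

text \<open>
  The compatibility relation gives the pairing of a product with every vector, and by nondegeneracy
  these pairings determine it, so bilinearity is inherited from the bracket and the form.
\<close>

lemma compatible_product_bilinear:
  assumes pl: "\<And>x y z. \<omega> (pl x y) z = - \<omega> y (br x z)"
  shows "bilinear_algebra scale pl"
proof unfold_locales
  show "bilinear_map scale scale scale pl"
    unfolding bilinear_map_iff[OF vector_space_axioms vector_space_axioms vector_space_axioms]
    by (intro conjI allI form_eqI)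
      (simp_all add: pl product_add product_scale form_add form_scale)
qed

lemma compatible_product_commutator:
  assumes pl: "\<And>x y z. \<omega> (pl x y) z = - \<omega> y (br x z)"
  shows "commutator pl x y = br x y"
proof (rule form_eqI)
  fix z
  have "\<omega> (br x y) z = - \<omega> (br z x) y - \<omega> (br y z) x"
    using closed_form[of x y z] by (simp add: algebra_simps eq_neg_iff_add_eq_0)
  also have "\<dots> = - \<omega> y (br x z) + \<omega> x (br y z)"
    using skew[of "br z x" y] skew[of "br y z" x] bracket_skew[of z x]
    by (simp add: form_minus_right)
  finally show "\<omega> (commutator pl x y) z = \<omega> (br x y) z"
    by (simp add: commutator_def form_diff_left pl)
qed

text \<open>
  Left multiplication is, up to sign, adjoint to the adjoint representation, so it is the dual
  representation: the commutator of two left multiplications is left multiplication by the bracket.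
  As the commutator of the product is the bracket, this is the symmetry of the associator.
\<close>

lemma compatible_product_pre_lie:
  assumes pl: "\<And>x y z. \<omega> (pl x y) z = - \<omega> y (br x z)"
  shows "pre_lie_algebra scale pl"
proof -
  interpret product: bilinear_algebra scale pl
    by (rule compatible_product_bilinear[OF pl])
  show ?thesis
  proof unfold_locales
    fix x y z
    have representation: "pl (br x y) z = pl x (pl y z) - pl y (pl x z)"
    proof (rule form_eqI)
      fix w
      have "br (br x y) w = br x (br y w) - br y (br x w)"
        using jacobi[of x y w] bracket_skew[of w "br x y"]
        by (simp add: bracket_skew[of w x] product_minus add_eq_0_iff)
      then show "\<omega> (pl (br x y) z) w = \<omega> (pl x (pl y z) - pl y (pl x z)) w"
        by (simp add: pl form_diff_left form_diff_right)
    qed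
    have "pl (pl x y) z - pl (pl y x) z = pl (br x y) z"
      by (simp add: product.product_diff commutator_def flip: compatible_product_commutator[OF pl])
    then show "pl (pl x y) z - pl x (pl y z) = pl (pl y x) z - pl y (pl x z)"
      by (simp add: representation algebra_simps)
  qed
qed

lemma compatible_product_quadratic:
  assumes pl: "\<And>x y z. \<omega> (pl x y) z = - \<omega> y (br x z)"
  shows "quadratic_pre_lie_algebra scale pl \<omega>"
proof -
  interpret pre_lie_algebra scale pl
    by (rule compatible_product_pre_lie[OF pl])
  show ?thesis
    by unfold_locales (simp add: pl compatible_product_commutator[OF pl])
qed

end


section \<open>Para-Kaehler Lie algebras\<close>

context para_kaehler_lie_algebra
begin

text \<open>
  Pairing with \<open>z\<close> and taking adjoints turns the claim into
  \<open>N [N x, z] = [N x, N z] - N [x, N z] + [x, N (N z)]\<close>. In the last term \<open>N (N z) = z\<close>, and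
  \<open>[x, z] = N (N [x, z])\<close> makes this the Nijenhuis identity of the bracket.
\<close>

lemma compatible_product_nijenhuis:
  assumes pl: "\<And>x y z. \<omega> (pl x y) z = - \<omega> y (br x z)"
  shows "nijenhuis_operator scale pl N"
proof -
  interpret product: bilinear_algebra scale pl
    by (rule compatible_product_bilinear[OF pl])
  show ?thesis
  proof unfold_locales
    fix x y
    show "pl (N x) (N y) = N (pl (N x) y + pl x (N y) - N (pl x y))"
    proof (rule form_eqI)
      fix z
      have dual: "N (br (N x) z) = br (N x) (N z) - N (br x (N z)) + br x z"
        by (simp add: nijenhuis N_add N_diff involution)
      have "\<omega> (N (pl (N x) y + pl x (N y) - N (pl x y))) z
          = \<omega> y (br (N x) (N z)) + \<omega> (N y) (br x (N z)) + \<omega> y (br x z)"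
        by (simp add: form_N_skew form_add form_diff_left pl involution)
      also have "\<dots> = \<omega> y (N (br (N x) z))"
        by (simp add: dual form_N_skew form_add form_diff_right)
      finally show "\<omega> (pl (N x) (N y)) z
          = \<omega> (N (pl (N x) y + pl x (N y) - N (pl x y))) z"
        by (simp add: pl form_N_skew)
    qed
  qed (simp_all add: N_add N_scale)
qed

lemma compatible_product_para_complex:
  assumes pl: "\<And>x y z. \<omega> (pl x y) z = - \<omega> y (br x z)"
  shows "para_complex_quadratic_pre_lie_algebra scale pl \<omega> N"
proof -
  interpret quadratic: quadratic_pre_lie_algebra scale pl \<omega>
    by (rule compatible_product_quadratic[OF pl])
  interpret product: nijenhuis_operator scale pl N
    by (rule compatible_product_nijenhuis[OF pl])
  show ?thesis
    by unfold_locales (simp_all add: involution dim_kernels_eq form_N_skew)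
qed

text \<open>
  Moving \<open>N\<close> across the form, \<open>\<omega> [x, y]\<^sub>N z = \<omega> [N x, y] z + \<omega> [x, N y] z + \<omega> [x, y] (N z)\<close>,
  which is symmetric in the position of \<open>N\<close>. So its cyclic sum splits into the closedness identities
  for \<open>(N x, y, z)\<close>, \<open>(x, N y, z)\<close> and \<open>(x, y, N z)\<close>.
\<close>

lemma symplectic_deformed: "symplectic_lie_algebra scale (deformed_product br N) \<omega>"
proof -
  interpret deformed: lie_algebra scale "deformed_product br N"
    by (rule lie_algebra_deformed[OF lie_algebra_axioms nijenhuis_operator_axioms])
  have form_deformed: "\<omega> (deformed_product br N x y) z
      = \<omega> (br (N x) y) z + \<omega> (br x (N y)) z + \<omega> (br x y) (N z)" for x y z
    by (simp add: deformed_product_def form_add form_diff_left form_N_skew)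
  show ?thesis
  proof unfold_locales
    fix x y z
    have "\<omega> (deformed_product br N x y) z + \<omega> (deformed_product br N z x) y
          + \<omega> (deformed_product br N y z) x
        = (\<omega> (br (N x) y) z + \<omega> (br z (N x)) y + \<omega> (br y z) (N x))
          + (\<omega> (br x (N y)) z + \<omega> (br z x) (N y) + \<omega> (br (N y) z) x)
          + (\<omega> (br x y) (N z) + \<omega> (br (N z) x) y + \<omega> (br y (N z)) x)"
      by (simp add: form_deformed)
    also have "\<dots> = 0"
      unfolding closed_form by simp
    finally show "\<omega> (deformed_product br N x y) z + \<omega> (deformed_product br N z x) y
        + \<omega> (deformed_product br N y z) x = 0" .
  qed
qed

lemma para_kaehler_deformed: "para_kaehler_lie_algebra scale (deformed_product br N) \<omega> N"
proof -
  interpret deformed: symplectic_lie_algebra scale "deformed_product br N" \<omega>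
    by (rule symplectic_deformed)
  interpret deformed: nijenhuis_operator scale "deformed_product br N" N
    by (rule nijenhuis_deformed)
  show ?thesis
    by unfold_locales (simp_all add: involution dim_kernels_eq form_N_skew)
qed

lemma deformed_product_compatible:
  assumes pl: "\<And>x y z. \<omega> (pl x y) z = - \<omega> y (br x z)"
  shows "\<omega> (deformed_product pl N x y) z = - \<omega> y (deformed_product br N x z)"
  by (simp add: deformed_product_def form_add form_diff_left form_diff_right pl form_N_skew)

end


section \<open>The associated product and its deformation\<close>

theorem theorem7p7:
  fixes scale :: "'k::{alg_closed_field, field_char_0} \<Rightarrow> 'v::ab_group_add \<Rightarrow> 'v"
    and B :: "'v set"
    and br :: "'v \<Rightarrow> 'v \<Rightarrow> 'v" and \<omega> :: "'v \<Rightarrow> 'v \<Rightarrow> 'k" and N :: "'v \<Rightarrow> 'v"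
  assumes "finite_dimensional_vector_space scale B"
    and "para_kaehler_lie_algebra scale br \<omega> N"
  shows
    "para_complex_quadratic_pre_lie_algebra scale (associated_product \<omega> br) \<omega> N \<and>
     (symplectic_lie_algebra scale (deformed_product br N) \<omega> \<and>
      para_kaehler_lie_algebra scale (deformed_product br N) \<omega> N) \<and>
     (pre_lie_algebra scale (deformed_product (associated_product \<omega> br) N) \<and>
      deformed_product (associated_product \<omega> br) N =
        associated_product \<omega> (deformed_product br N) \<and>
      (\<forall>x y z. \<omega> (deformed_product (associated_product \<omega> br) N x y) z =
        - \<omega> y (deformed_product br N x z)))"
proof -
  interpret para_kaehler_lie_algebra scale br \<omega> N by (rule assms(2))
  interpret deformed: symplectic_lie_algebra scale "deformed_product br N" \<omega>
    by (rule symplectic_deformed)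
  note pl = associated_product_form[OF assms(1)]
  note pl_deformed = deformed_product_compatible[OF pl]
  show ?thesis
    using compatible_product_para_complex[OF pl] symplectic_deformed para_kaehler_deformed
      deformed.compatible_product_pre_lie[OF pl_deformed]
      deformed.associated_product_unique[OF pl_deformed] pl_deformed
    by blast
qed

end
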